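(* Let $D < D'$ be positive integers, and let $$\mathbb{X}_{D+1}=\{\mathbf{x}^{(\nu)}=(x_1^{(\nu)},\dots,x_D^{(\nu)},x_{D+1}^{(\nu)})\in\mathbb{R}^{D+1} : \nu=1,2,\dots,n\}\subset\mathbb{R}^{D+1}$$ be any given dataset of $n$ points in $\mathbb{R}^{D+1}$. There is a polynomial time dimensionality increase algorithm transforming the dataset $\mathbb{X}_{D+1}$ into a new isopleth dataset $$\mathbb{Y}_{D'+1}=\{\mathbf{y}^{(\nu)}=(y_1^{(\nu)},\dots,y_{D'}^{(\nu)},y_{D'+1}^{(\nu)})\in\mathbb{R}^{D'+1} : \nu=1,2,\dots,n\}\subset\mathbb{R}^{D'+1},$$ where $\mathbf{y}^{(\nu)}$ is the image of $\mathbf{x}^{(\nu)}$, in such a way that any angle formed by the points of $\mathbb{Y}_{D'+1}$ in $\mathbb{R}^{D'+1}$ is equal to the angle formed by the corresponding original points of $\mathbb{X}_{D+1}$ in $\mathbb{R}^{D+1}$; that is, for all pairwise distinct $i,j,k\in\{1,\dots,n\}$, $$\angle\big(\mathbf{y}^{(i)},\mathbf{y}^{(j)},\mathbf{y}^{(k)}\big)=\angle\big(\mathbf{x}^{(i)},\mathbf{x}^{(j)},\mathbf{x}^{(k)}\big).$$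
   Context: A dataset is a finite set of $n$ points (data vectors) in a Euclidean space, indexed by $\nu=1,\dots,n$; it is not assumed to have zero mean. "Isopleth" means that the new dataset has the same number $n$ of points as the original one, with the points in correspondence $\mathbf{x}^{(\nu)}\mapsto\mathbf{y}^{(\nu)}$. The algorithm is meant to apply to every dataset. For points $a,b,c$ of a Euclidean space with $a\neq b$ and $c\neq b$, $\angle(a,b,c)\in[0,\pi]$ denotes the angle with vertex $b$ between the rays from $b$ through $a$ and through $c$, i.e. $\angle(a,b,c)=\arccos\left(\frac{(a-b)\cdot(c-b)}{\|a-b\|\,\|c-b\|}\right)$, with the Euclidean dot product and norm. Polynomial time means that the number of elementary numerical operations on real numbers (additions, subtractions, multiplications, divisions, square root extractions) performed by the algorithm is bounded by a polynomial in $n$, $D$ and $D'$. *)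

theory Defs
  imports Complex_Main "Jordan_Normal_Form.Matrix"
begin

section \<open>Datasets and angles\<close>

text \<open>The dimension is a value of the statement, not a type, so a point of Euclidean \<open>d\<close>-space is
  an element of \<open>carrier_vec d\<close>. The points are numbered from \<open>0\<close> to \<open>n - 1\<close>. The origin plays
  no special role: the mean is not assumed to be zero.\<close>

definition dataset :: "nat \<Rightarrow> nat \<Rightarrow> real vec list \<Rightarrow> bool" where
  "dataset n d xs \<longleftrightarrow> length xs = n \<and> distinct xs \<and> set xs \<subseteq> carrier_vec d"

definition eucl_norm :: "real vec \<Rightarrow> real" where
  "eucl_norm v = sqrt (v \<bullet> v)"

definition angle :: "real vec \<Rightarrow> real vec \<Rightarrow> real vec \<Rightarrow> real" where
  "angle a b c = arccos (((a - b) \<bullet> (c - b)) / (eucl_norm (a - b) * eucl_norm (c - b)))"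


section \<open>Algorithms: a random access machine over the real numbers\<close>

text \<open>A program uses natural-number registers, needed for dimensions, loop counters and addresses,
  and countably many arrays of real numbers. A cell \<open>(a, v)\<close> denotes the entry of array \<open>a\<close> at
  the address stored in register \<open>v\<close>. The size of a program is independent of its input: one and
  the same program has to work for all \<open>n\<close>, \<open>D\<close>, \<open>D'\<close> and all datasets. The only real constants
  are rational, and registers can only be added and (truncatedly) subtracted in one step.\<close>

type_synonym register = nat
type_synonym cell = "nat \<times> register"

datatype arith_op = Plus | Minus | Times | Divide

datatype test =
    Reg_Less register register
  | Real_Less cell cell

datatype program =
    Skip
  | Reg_Const register nat
  | Reg_Add register register register
  | Reg_Sub register register register
  | Real_Const cell rat
  | Real_Copy cell cell
  | Real_Op arith_op cell cell cell
  | Real_Sqrt cell cell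
  | Seq program program
  | If test program program
  | While test program

record state =
  regs :: "register \<Rightarrow> nat"
  reals :: "nat \<Rightarrow> nat \<Rightarrow> real"

definition get_real :: "state \<Rightarrow> cell \<Rightarrow> real" where
  "get_real s c = reals s (fst c) (regs s (snd c))"

definition set_real :: "state \<Rightarrow> cell \<Rightarrow> real \<Rightarrow> state" where
  "set_real s c r =
     s\<lparr>reals := (reals s)(fst c := (reals s (fst c))(regs s (snd c) := r))\<rparr>"

definition set_reg :: "state \<Rightarrow> register \<Rightarrow> nat \<Rightarrow> state" where
  "set_reg s v m = s\<lparr>regs := (regs s)(v := m)\<rparr>"

fun arith :: "arith_op \<Rightarrow> real \<Rightarrow> real \<Rightarrow> real" where
  "arith Plus x y = x + y"
| "arith Minus x y = x - y"
| "arith Times x y = x * y"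
| "arith Divide x y = x / y"

fun holds :: "test \<Rightarrow> state \<Rightarrow> bool" where
  "holds (Reg_Less v w) s \<longleftrightarrow> regs s v < regs s w"
| "holds (Real_Less c d) s \<longleftrightarrow> get_real s c < get_real s d"

text \<open>\<open>exec p s m t\<close>: started in state \<open>s\<close>, the program \<open>p\<close> halts in state \<open>t\<close> after \<open>m\<close> steps.
  Every addition, subtraction, multiplication, division and square root extraction on real
  numbers is one step. Bookkeeping (copying, constants, register operations, tests) is charged as
  well, so \<open>m\<close> bounds the number of elementary numerical operations and no work is free.
  Division by zero and the square root of a negative number have no rule: a program attempting
  them does not halt, in spite of the total functions \<open>(/)\<close> and \<open>sqrt\<close>.\<close>

inductive exec :: "program \<Rightarrow> state \<Rightarrow> nat \<Rightarrow> state \<Rightarrow> bool" where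
  Skip: "exec Skip s 1 s"
| Reg_Const: "exec (Reg_Const v m) s 1 (set_reg s v m)"
| Reg_Add: "exec (Reg_Add v u w) s 1 (set_reg s v (regs s u + regs s w))"
| Reg_Sub: "exec (Reg_Sub v u w) s 1 (set_reg s v (regs s u - regs s w))"
| Real_Const: "exec (Real_Const c q) s 1 (set_real s c (of_rat q))"
| Real_Copy: "exec (Real_Copy c d) s 1 (set_real s c (get_real s d))"
| Real_Op: "(f = Divide \<Longrightarrow> get_real s e \<noteq> 0) \<Longrightarrow>
    exec (Real_Op f c d e) s 1 (set_real s c (arith f (get_real s d) (get_real s e)))"
| Real_Sqrt: "get_real s d \<ge> 0 \<Longrightarrow>
    exec (Real_Sqrt c d) s 1 (set_real s c (sqrt (get_real s d)))"
| Seq: "exec p s l t \<Longrightarrow> exec q t m u \<Longrightarrow> exec (Seq p q) s (l + m) u"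
| If_True: "holds b s \<Longrightarrow> exec p s m t \<Longrightarrow> exec (If b p q) s (1 + m) t"
| If_False: "\<not> holds b s \<Longrightarrow> exec q s m t \<Longrightarrow> exec (If b p q) s (1 + m) t"
| While_False: "\<not> holds b s \<Longrightarrow> exec (While b p) s 1 s"
| While_True: "holds b s \<Longrightarrow> exec p s l t \<Longrightarrow> exec (While b p) t m u \<Longrightarrow>
    exec (While b p) s (1 + l + m) u"

lemma exec_deterministic:
  assumes "exec p s m t" and "exec p s m' t'"
  shows "m' = m \<and> t' = t"
  using assms
proof (induction arbitrary: m' t' rule: exec.induct)
  case (Seq p s l t q m u)
  from Seq.prems show ?case by cases (use Seq.IH in blast)+
next
  case (While_True b s p l t m u)
  from While_True.prems show ?case
    by cases (use While_True.IH While_True.hyps in blast)+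
qed (erule exec.cases; simp)+

text \<open>Initially registers 0, 1, 2 hold \<open>n\<close>, \<open>D\<close>, \<open>D'\<close>, array 0 holds the coordinates of the \<open>n\<close>
  points of \<open>(D + 1)\<close>-space one point after the other, and everything else is zero. On
  termination the \<open>n\<close> new points of \<open>(D' + 1)\<close>-space are read off from array 1 in the same layout.\<close>

definition initial_state :: "nat \<Rightarrow> nat \<Rightarrow> real vec list \<Rightarrow> state" where
  "initial_state D D' xs =
     \<lparr>regs = (\<lambda>_. 0)(0 := length xs, 1 := D, 2 := D'),
      reals = (\<lambda>a k. if a = 0 \<and> k < length xs * (D + 1)
                     then xs ! (k div (D + 1)) $ (k mod (D + 1)) else 0)\<rparr>"

definition output_points :: "nat \<Rightarrow> nat \<Rightarrow> state \<Rightarrow> real vec list" where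
  "output_points n D' t =
     map (\<lambda>\<nu>. vec (D' + 1) (\<lambda>i. reals t 1 (\<nu> * (D' + 1) + i))) [0..<n]"

definition transforms ::
  "program \<Rightarrow> nat \<Rightarrow> nat \<Rightarrow> real vec list \<Rightarrow> nat \<Rightarrow> real vec list \<Rightarrow> bool" where
  "transforms p D D' xs m ys \<longleftrightarrow>
     (\<exists>t. exec p (initial_state D D' xs) m t \<and> ys = output_points (length xs) D' t)"

definition polynomial3 :: "(nat \<Rightarrow> nat \<Rightarrow> nat \<Rightarrow> real) \<Rightarrow> bool" where
  "polynomial3 P \<longleftrightarrow>
     (\<exists>(M :: (nat \<times> nat \<times> nat) set) (c :: nat \<times> nat \<times> nat \<Rightarrow> real). finite M \<and>
        P = (\<lambda>x y z. \<Sum>(i, j, k)\<in>M. c (i, j, k) * real x ^ i * real y ^ j * real z ^ k))"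

end

theory Submission
  imports Defs
begin

text \<open>Appending \<open>D' - D\<close> zero coordinates to every point embeds \<open>(D + 1)\<close>-space isometrically and
  linearly into \<open>(D' + 1)\<close>-space. Differences and scalar products survive the embedding, and the
  angle is a function of these alone, so every angle is preserved (\<open>angle_zero_pad\<close>); distinct
  points stay distinct because the embedding is injective.

  What remains is to have one fixed program carry out the embedding. It copies the rows of length
  \<open>D + 1\<close> of the input array into an output array with rows of length \<open>D' + 1\<close>. Since all cells of
  the output array start at zero, the padding itself costs nothing: the program only advances the
  output address across the gap of length \<open>D' - D\<close>. No real arithmetic occurs, so no operation
  can fail, and two nested loops of \<open>n\<close> and \<open>D + 1\<close> rounds give a running time of
  \<open>5 n D + 10 n + 4\<close> (\<open>runs_pad_program\<close>).\<close>

section \<open>Zero padding\<close>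

definition zero_pad :: "nat \<Rightarrow> real vec \<Rightarrow> real vec" where
  "zero_pad k v = v @\<^sub>v 0\<^sub>v k"

lemma zero_pad_carrier: "v \<in> carrier_vec d \<Longrightarrow> zero_pad k v \<in> carrier_vec (d + k)"
  by (simp add: zero_pad_def)

lemma zero_pad_minus:
  assumes "v \<in> carrier_vec d" "w \<in> carrier_vec d"
  shows "zero_pad k v - zero_pad k w = zero_pad k (v - w)"
  using assms by (intro eq_vecI) (auto simp: zero_pad_def)

lemma scalar_prod_zero_pad:
  assumes "v \<in> carrier_vec d" "w \<in> carrier_vec d"
  shows "zero_pad k v \<bullet> zero_pad k w = v \<bullet> w"
  using assms by (simp add: zero_pad_def scalar_prod_append[of _ d _ k])

lemma angle_zero_pad:
  assumes "a \<in> carrier_vec d" "b \<in> carrier_vec d" "c \<in> carrier_vec d"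
  shows "angle (zero_pad k a) (zero_pad k b) (zero_pad k c) = angle a b c"
proof -
  have "a - b \<in> carrier_vec d" "c - b \<in> carrier_vec d"
    using assms by auto
  then show ?thesis
    using assms
    by (simp add: angle_def eucl_norm_def zero_pad_minus[of _ d] scalar_prod_zero_pad[of _ d])
qed

lemma dataset_zero_pad:
  assumes "dataset n d xs"
  shows "dataset n (d + k) (map (zero_pad k) xs)"
proof -
  have "inj_on (zero_pad k) (set xs)"
  proof (rule inj_onI)
    fix v w
    assume "v \<in> set xs" "w \<in> set xs" and eq: "zero_pad k v = zero_pad k w"
    then have "v \<in> carrier_vec d" "w \<in> carrier_vec d"
      using assms by (auto simp: dataset_def)
    then show "v = w"
      using eq unfolding zero_pad_def by (simp add: append_vec_eq)
  qed
  then show ?thesis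
    using assms by (auto simp: dataset_def distinct_map intro!: zero_pad_carrier)
qed


section \<open>Total correctness with exact running time\<close>

text \<open>Stating postconditions as predicates makes it possible to run through a sequence of
  instructions without ever writing down the intermediate states.\<close>

definition runs :: "program \<Rightarrow> state \<Rightarrow> nat \<Rightarrow> (state \<Rightarrow> bool) \<Rightarrow> bool" where
  "runs p s m Q \<longleftrightarrow> (\<exists>t. exec p s m t \<and> Q t)"

lemma runs_Reg_Const: "Q (set_reg s v m) \<Longrightarrow> runs (Reg_Const v m) s 1 Q"
  unfolding runs_def by (blast intro: exec.Reg_Const)

lemma runs_Reg_Add: "Q (set_reg s v (regs s u + regs s w)) \<Longrightarrow> runs (Reg_Add v u w) s 1 Q"
  unfolding runs_def by (blast intro: exec.Reg_Add)

lemma runs_Reg_Sub: "Q (set_reg s v (regs s u - regs s w)) \<Longrightarrow> runs (Reg_Sub v u w) s 1 Q"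
  unfolding runs_def by (blast intro: exec.Reg_Sub)

lemma runs_Real_Copy: "Q (set_real s c (get_real s d)) \<Longrightarrow> runs (Real_Copy c d) s 1 Q"
  unfolding runs_def by (blast intro: exec.Real_Copy)

lemma runs_Seq:
  assumes "runs p s l (\<lambda>t. runs q t m Q)"
  shows "runs (Seq p q) s (l + m) Q"
  using assms unfolding runs_def by (blast intro: exec.Seq)

lemma runs_mono: "runs p s m Q \<Longrightarrow> (\<And>t. Q t \<Longrightarrow> R t) \<Longrightarrow> runs p s m R"
  unfolding runs_def by blast

text \<open>A loop whose invariant \<open>I\<close> is indexed by the number of completed rounds, and therefore
  determines when the guard fails: each round costs the body plus one test, and the last, failing
  test costs one more step.\<close>

lemma runs_counted_While:
  assumes guard: "\<And>i s. I i s \<Longrightarrow> i \<le> N \<Longrightarrow> holds b s \<longleftrightarrow> i < N"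
    and body: "\<And>i s. I i s \<Longrightarrow> i < N \<Longrightarrow> runs p s c (I (Suc i))"
    and start: "I 0 s"
  shows "runs (While b p) s (N * (c + 1) + 1) (I N)"
proof -
  have "runs (While b p) s (k * (c + 1) + 1) (I N)" if "I (N - k) s" "k \<le> N" for k s
    using that
  proof (induction k arbitrary: s)
    case 0
    then have "\<not> holds b s"
      using guard[of N s] by simp
    then have "exec (While b p) s 1 s"
      by (rule exec.While_False)
    with 0 show ?case
      unfolding runs_def by auto
  next
    case (Suc k)
    have less: "N - Suc k < N" and next_round: "Suc (N - Suc k) = N - k"
      using Suc.prems(2) by auto
    obtain t where t: "exec p s c t" "I (N - k) t"
      using body[OF Suc.prems(1) less] unfolding runs_def next_round by blast
    obtain u where u: "exec (While b p) t (k * (c + 1) + 1) u" "I N u"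
      using Suc.IH[OF t(2)] Suc.prems(2) unfolding runs_def by auto
    have "holds b s"
      using guard[OF Suc.prems(1)] less by simp
    then have "exec (While b p) s (1 + c + (k * (c + 1) + 1)) u"
      using t(1) u(1) by (rule exec.While_True)
    moreover have "1 + c + (k * (c + 1) + 1) = Suc k * (c + 1) + 1"
      by simp
    ultimately show ?case
      using u(2) unfolding runs_def by metis
  qed
  from this[of N s] start show ?thesis
    by simp
qed


section \<open>The padding program\<close>

text \<open>Register 4 counts the completed points and register 5 the copied coordinates of the current
  one; registers 6 and 7 are the input and output addresses. Registers 3, 8 and 9 hold the constants
  \<open>1\<close>, \<open>D + 1\<close> and \<open>D' - D\<close>.\<close>

definition copy_coordinate :: program where
  "copy_coordinate =
     Seq (Real_Copy (1, 7) (0, 6))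
    (Seq (Reg_Add 6 6 3)
    (Seq (Reg_Add 7 7 3)
         (Reg_Add 5 5 3)))"

definition copy_point :: program where
  "copy_point =
     Seq (Reg_Const 5 0)
    (Seq (While (Reg_Less 5 8) copy_coordinate)
    (Seq (Reg_Add 7 7 9)
         (Reg_Add 4 4 3)))"

definition pad_program :: program where
  "pad_program =
     Seq (Reg_Const 3 1)
    (Seq (Reg_Add 8 1 3)
    (Seq (Reg_Sub 9 2 1)
         (While (Reg_Less 4 0) copy_point)))"

text \<open>The output array once all cells below address \<open>K\<close> have their final value: the array \<open>a\<close> with
  rows of length \<open>D + 1\<close>, spread out to rows of length \<open>D' + 1\<close>. Measuring progress by a single
  address lets the gap at the end of a row be skipped without any change of the array.\<close>

definition padded_prefix :: "nat \<Rightarrow> nat \<Rightarrow> (nat \<Rightarrow> real) \<Rightarrow> nat \<Rightarrow> nat \<Rightarrow> real" where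
  "padded_prefix D D' a K k =
     (if k < K \<and> k mod (D' + 1) \<le> D
      then a (k div (D' + 1) * (D + 1) + k mod (D' + 1)) else 0)"

lemma padded_prefix_0: "padded_prefix D D' a 0 = (\<lambda>_. 0)"
  by (simp add: padded_prefix_def fun_eq_iff)

lemma row_address:
  fixes i d :: nat
  assumes "i < d"
  shows "(\<nu> * d + i) div d = \<nu>" "(\<nu> * d + i) mod d = i"
  using assms by simp_all

lemma padded_prefix_copy:
  assumes "i \<le> D" "D < D'"
  shows "(padded_prefix D D' a (\<nu> * (D' + 1) + i))(\<nu> * (D' + 1) + i := a (\<nu> * (D + 1) + i)) =
    padded_prefix D D' a (\<nu> * (D' + 1) + Suc i)"
proof -
  have "(\<nu> * (D' + 1) + i) div (D' + 1) = \<nu>" "(\<nu> * (D' + 1) + i) mod (D' + 1) = i"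
    using assms by (auto intro!: row_address simp del: mult_Suc_right)
  then show ?thesis
    using assms by (auto simp: padded_prefix_def fun_eq_iff less_Suc_eq)
qed

lemma padded_prefix_gap:
  assumes "D < D'"
  shows "padded_prefix D D' a (\<nu> * (D' + 1) + (D + 1)) = padded_prefix D D' a (Suc \<nu> * (D' + 1))"
proof
  fix k
  have "k < \<nu> * (D' + 1) + (D + 1)" if less: "k < Suc \<nu> * (D' + 1)" and small: "k mod (D' + 1) \<le> D"
  proof -
    have "k div (D' + 1) \<le> \<nu>"
      using less by (metis less_Suc_eq_le less_mult_imp_div_less)
    then have "k div (D' + 1) * (D' + 1) \<le> \<nu> * (D' + 1)"
      by (rule mult_le_mono1)
    then show ?thesis
      using small div_mult_mod_eq[of k "D' + 1"] by linarith
  qed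
  moreover have "k < Suc \<nu> * (D' + 1)" if "k < \<nu> * (D' + 1) + (D + 1)"
    using that assms by simp
  ultimately show "padded_prefix D D' a (\<nu> * (D' + 1) + (D + 1)) k =
      padded_prefix D D' a (Suc \<nu> * (D' + 1)) k"
    unfolding padded_prefix_def by auto
qed

text \<open>The state after \<open>\<nu>\<close> points and \<open>i\<close> coordinates of the next point have been copied. The
  counter of register 5 is left out, as it is only meaningful inside the inner loop.\<close>

definition pad_progress ::
  "nat \<Rightarrow> nat \<Rightarrow> nat \<Rightarrow> (nat \<Rightarrow> real) \<Rightarrow> nat \<Rightarrow> nat \<Rightarrow> state \<Rightarrow> bool" where
  "pad_progress n D D' a \<nu> i s \<longleftrightarrow>
     regs s 0 = n \<and> regs s 3 = 1 \<and> regs s 8 = D + 1 \<and> regs s 9 = D' - D \<and>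
     regs s 4 = \<nu> \<and> regs s 6 = \<nu> * (D + 1) + i \<and> regs s 7 = \<nu> * (D' + 1) + i \<and>
     reals s 0 = a \<and> reals s 1 = padded_prefix D D' a (\<nu> * (D' + 1) + i)"

lemma runs_copy_coordinate:
  assumes "pad_progress n D D' a \<nu> i s" "regs s 5 = i" "i < D + 1" "D < D'"
  shows "runs copy_coordinate s 4 (\<lambda>t. pad_progress n D D' a \<nu> (Suc i) t \<and> regs t 5 = Suc i)"
proof -
  have "runs copy_coordinate s (1 + (1 + (1 + 1)))
      (\<lambda>t. pad_progress n D D' a \<nu> (Suc i) t \<and> regs t 5 = Suc i)"
    unfolding copy_coordinate_def
    by (intro runs_Seq runs_Real_Copy runs_Reg_Add)
      (use assms padded_prefix_copy[of i D D' a \<nu>] in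
        \<open>simp add: pad_progress_def set_reg_def set_real_def get_real_def\<close>)
  then show ?thesis
    by (simp add: numeral_eq_Suc)
qed

lemma runs_copy_point:
  assumes "pad_progress n D D' a \<nu> 0 s" "D < D'"
  shows "runs copy_point s (5 * D + 9) (pad_progress n D D' a (Suc \<nu>) 0)"
proof -
  let ?I = "\<lambda>i t. pad_progress n D D' a \<nu> i t \<and> regs t 5 = i"
  have loop: "runs (While (Reg_Less 5 8) copy_coordinate) t ((D + 1) * (4 + 1) + 1) (?I (D + 1))"
    if "?I 0 t" for t
  proof (rule runs_counted_While[where I = ?I])
    show "holds (Reg_Less 5 8) u \<longleftrightarrow> i < D + 1" if "?I i u" for i u
      using that by (simp add: pad_progress_def)
    show "runs copy_coordinate u 4 (?I (Suc i))" if "?I i u" "i < D + 1" for i u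
      using that assms(2) by (intro runs_copy_coordinate) auto
  qed (fact that)
  have "runs copy_point s (1 + (((D + 1) * (4 + 1) + 1) + (1 + 1)))
      (pad_progress n D D' a (Suc \<nu>) 0)"
    unfolding copy_point_def
  proof (intro runs_Seq runs_Reg_Const runs_mono[OF loop] runs_Reg_Add)
    show "?I 0 (set_reg s 5 0)"
      using assms(1) by (simp add: pad_progress_def set_reg_def)
  next
    fix t
    assume t: "?I (D + 1) t"
    then show "pad_progress n D D' a (Suc \<nu>) 0
        (set_reg (set_reg t 7 (regs t 7 + regs t 9)) 4
          (regs (set_reg t 7 (regs t 7 + regs t 9)) 4 +
           regs (set_reg t 7 (regs t 7 + regs t 9)) 3))"
      using assms(2) padded_prefix_gap[OF assms(2), of a \<nu>]
      by (simp add: pad_progress_def set_reg_def)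
  qed
  then show ?thesis
    by (simp add: algebra_simps)
qed

lemma runs_pad_program:
  assumes "D < D'"
    and "regs s = (\<lambda>_. 0)(0 := n, 1 := D, 2 := D')" "reals s 0 = a" "reals s 1 = (\<lambda>_. 0)"
  shows "runs pad_program s (5 * n * D + 10 * n + 4)
    (\<lambda>t. reals t 1 = padded_prefix D D' a (n * (D' + 1)))"
proof -
  let ?I = "\<lambda>\<nu> t. pad_progress n D D' a \<nu> 0 t"
  have loop: "runs (While (Reg_Less 4 0) copy_point) t (n * ((5 * D + 9) + 1) + 1) (?I n)"
    if "?I 0 t" for t
  proof (rule runs_counted_While[where I = ?I])
    show "holds (Reg_Less 4 0) u \<longleftrightarrow> \<nu> < n" if "?I \<nu> u" for \<nu> u
      using that by (simp add: pad_progress_def)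
    show "runs copy_point u (5 * D + 9) (?I (Suc \<nu>))" if "?I \<nu> u" for \<nu> u
      using that assms(1) by (rule runs_copy_point)
  qed (fact that)
  have "runs pad_program s (1 + (1 + (1 + (n * ((5 * D + 9) + 1) + 1)))) (?I n)"
    unfolding pad_program_def
    by (intro runs_Seq runs_Reg_Const runs_Reg_Add runs_Reg_Sub loop)
      (use assms in \<open>simp add: pad_progress_def set_reg_def padded_prefix_0\<close>)
  moreover have "1 + (1 + (1 + (n * ((5 * D + 9) + 1) + 1))) = 5 * n * D + 10 * n + 4"
    by (simp add: algebra_simps)
  ultimately have "runs pad_program s (5 * n * D + 10 * n + 4) (?I n)"
    by metis
  then show ?thesis
    by (rule runs_mono) (simp add: pad_progress_def)
qed

lemma output_points_padded_prefix:
  assumes xs: "dataset n (D + 1) xs" and "D < D'"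
    and t: "reals t 1 = padded_prefix D D' (reals (initial_state D D' xs) 0) (n * (D' + 1))"
  shows "output_points n D' t = map (zero_pad (D' - D)) xs"
proof (rule nth_equalityI)
  show "length (output_points n D' t) = length (map (zero_pad (D' - D)) xs)"
    using xs by (simp add: output_points_def dataset_def)
  fix \<nu>
  assume "\<nu> < length (output_points n D' t)"
  then have \<nu>: "\<nu> < n"
    by (simp add: output_points_def)
  have len: "length xs = n"
    using xs by (simp add: dataset_def)
  then have "xs ! \<nu> \<in> carrier_vec (D + 1)"
    using \<nu> xs unfolding dataset_def by (metis nth_mem subsetD)
  then have dim: "dim_vec (xs ! \<nu>) = D + 1"
    by simp
  have row_end: "\<mu> * d + d \<le> n * d" if "\<mu> < n" for \<mu> d :: nat
    using that mult_le_mono1[of "Suc \<mu>" n d] by simp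
  have entry: "reals t 1 (\<nu> * (D' + 1) + i) = (if i \<le> D then xs ! \<nu> $ i else 0)"
    if i: "i < D' + 1" for i
  proof -
    have out: "(\<nu> * (D' + 1) + i) div (D' + 1) = \<nu>" "(\<nu> * (D' + 1) + i) mod (D' + 1) = i"
      using i by (rule row_address)+
    have inp: "(\<nu> * (D + 1) + i) div (D + 1) = \<nu>" "(\<nu> * (D + 1) + i) mod (D + 1) = i" if "i \<le> D"
      using that by (auto intro!: row_address simp del: mult_Suc_right)
    have "\<nu> * (D' + 1) + i < n * (D' + 1)"
      using row_end[OF \<nu>, of "D' + 1"] i by linarith
    moreover have "\<nu> * (D + 1) + i < n * (D + 1)" if "i \<le> D"
      using row_end[OF \<nu>, of "D + 1"] that by linarith
    ultimately show ?thesis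
      unfolding t padded_prefix_def out using inp len by (simp add: initial_state_def)
  qed
  have "vec (D' + 1) (\<lambda>i. reals t 1 (\<nu> * (D' + 1) + i)) = zero_pad (D' - D) (xs ! \<nu>)"
  proof (rule eq_vecI)
    fix i
    assume "i < dim_vec (zero_pad (D' - D) (xs ! \<nu>))"
    then have "i < D' + 1"
      using dim \<open>D < D'\<close> by (simp add: zero_pad_def)
    then show "vec (D' + 1) (\<lambda>i. reals t 1 (\<nu> * (D' + 1) + i)) $ i = zero_pad (D' - D) (xs ! \<nu>) $ i"
      using entry[of i] dim \<open>D < D'\<close> by (simp add: zero_pad_def)
  qed (use dim \<open>D < D'\<close> in \<open>simp add: zero_pad_def\<close>)
  then show "output_points n D' t ! \<nu> = map (zero_pad (D' - D)) xs ! \<nu>"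
    using \<nu> len by (simp add: output_points_def)
qed

lemma transforms_pad_program:
  assumes "dataset n (D + 1) xs" "D < D'"
  shows "transforms pad_program D D' xs (5 * n * D + 10 * n + 4) (map (zero_pad (D' - D)) xs)"
proof -
  have len: "length xs = n"
    using assms(1) by (simp add: dataset_def)
  have "runs pad_program (initial_state D D' xs) (5 * n * D + 10 * n + 4)
      (\<lambda>t. reals t 1 = padded_prefix D D' (reals (initial_state D D' xs) 0) (n * (D' + 1)))"
    by (rule runs_pad_program) (use assms len in \<open>auto simp: initial_state_def\<close>)
  then show ?thesis
    using output_points_padded_prefix[OF assms] len unfolding runs_def transforms_def by metis
qed

lemma polynomial3_pad_time:
  "polynomial3 (\<lambda>n D D'. real (5 * n * D + 10 * n + 4))"
proof -
  let ?c = "(\<lambda>_. 0)((1, 1, 0) := 5, (1, 0, 0) := 10, (0, 0, 0) := 4)"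
  have "finite {(1, 1, 0), (1, 0, 0), (0, 0, 0 :: nat)}"
    by simp
  then show ?thesis
    unfolding polynomial3_def
    by (intro exI[of _ "{(1, 1, 0), (1, 0, 0), (0, 0, 0)}"] exI[of _ ?c])
      (auto simp: fun_eq_iff)
qed

theorem theorem5:
  shows "\<exists>(p :: program) (P :: nat \<Rightarrow> nat \<Rightarrow> nat \<Rightarrow> real). polynomial3 P \<and>
    (\<forall>(n :: nat) (D :: nat) (D' :: nat) (xs :: real vec list).
       0 < D \<longrightarrow> D < D' \<longrightarrow> dataset n (D + 1) xs \<longrightarrow>
       (\<exists>(m :: nat) (ys :: real vec list).
          transforms p D D' xs m ys \<and>
          real m \<le> P n D D' \<and>
          dataset n (D' + 1) ys \<and>
          (\<forall>i<n. \<forall>j<n. \<forall>k<n. i \<noteq> j \<longrightarrow> j \<noteq> k \<longrightarrow> i \<noteq> k \<longrightarrow>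
             angle (ys ! i) (ys ! j) (ys ! k) = angle (xs ! i) (xs ! j) (xs ! k))))"
proof (intro exI[of _ pad_program] exI[of _ "\<lambda>n D D'. real (5 * n * D + 10 * n + 4)"] conjI
    polynomial3_pad_time allI impI)
  fix n D D' :: nat and xs :: "real vec list"
  assume "D < D'" and xs: "dataset n (D + 1) xs"
  let ?ys = "map (zero_pad (D' - D)) xs"
  have "transforms pad_program D D' xs (5 * n * D + 10 * n + 4) ?ys"
    using xs \<open>D < D'\<close> by (rule transforms_pad_program)
  moreover have "dataset n (D' + 1) ?ys"
    using dataset_zero_pad[OF xs, of "D' - D"] \<open>D < D'\<close> by simp
  moreover have "angle (?ys ! i) (?ys ! j) (?ys ! k) = angle (xs ! i) (xs ! j) (xs ! k)"
    if "i < n" "j < n" "k < n" for i j k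
  proof -
    have "length xs = n" and "set xs \<subseteq> carrier_vec (D + 1)"
      using xs by (auto simp: dataset_def)
    then have "xs ! l \<in> carrier_vec (D + 1)" if "l < n" for l
      using that by (metis nth_mem subsetD)
    then show ?thesis
      using that \<open>length xs = n\<close> by (simp add: angle_zero_pad[of _ "D + 1"])
  qed
  ultimately show "\<exists>m ys. transforms pad_program D D' xs m ys \<and>
      real m \<le> real (5 * n * D + 10 * n + 4) \<and> dataset n (D' + 1) ys \<and>
      (\<forall>i<n. \<forall>j<n. \<forall>k<n. i \<noteq> j \<longrightarrow> j \<noteq> k \<longrightarrow> i \<noteq> k \<longrightarrow>
         angle (ys ! i) (ys ! j) (ys ! k) = angle (xs ! i) (xs ! j) (xs ! k))"
    by blast
qed

end
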